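(* Let $A$ and $B$ be finite Abelian groups, $\pi:A\to B$ a group homomorphism, and $\zeta\in\hat{A}$ any character of $A$. Define $\pi^{\zeta}_*:\mathbb{C}[A]\to\mathbb{C}[B]$ by $$\pi^\zeta_*\varphi(b)=\sum_{a\in\pi^{-1}(b)}\overline{\zeta(a)}\,\varphi(a)\qquad(\varphi\in\mathbb{C}[A],\ b\in B),$$ define $\hat\pi_\zeta:\hat B\to\hat A$ by $\hat\pi_\zeta\xi=(\xi\circ\pi)\cdot\zeta$, and let $\hat\pi_\zeta^*:\mathbb{C}[\hat A]\to\mathbb{C}[\hat B]$ be the pull-back $\hat\pi_\zeta^*\psi=\psi\circ\hat\pi_\zeta$. Then $$\hat\pi_\zeta^*\circ\mathcal{F}_A=\mathcal{F}_B\circ\pi^\zeta_*.$$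
   Context: For a finite Abelian group $A$, $\hat A$ is its group of complex characters, $\mathbb{C}[A]$ and $\mathbb{C}[\hat A]$ are the spaces of complex valued functions on $A$ and $\hat A$, and the Fourier transformation $\mathcal{F}_A:\mathbb{C}[A]\to\mathbb{C}[\hat A]$ is $\mathcal{F}_A\varphi(\xi)=\sum_{a\in A}\overline{\xi(a)}\varphi(a)$. *)

theory Defs
  imports "HOL-Algebra.Group" Complex_Main
begin

text \<open>
  Groups are given by HOL-Algebra structures (written multiplicatively). A function on a set is
  represented by its extensional representative (see \<^theory>\<open>HOL-Library.FuncSet\<close>), so that
  equality of HOL functions is equality of functions on the given domain.
\<close>

definition complex_units :: "complex monoid" where
  "complex_units = \<lparr>carrier = UNIV - {0}, mult = (*), one = 1\<rparr>"

definition character_group :: "('a, 'm) monoid_scheme \<Rightarrow> ('a \<Rightarrow> complex) monoid" where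
  "character_group A =
     \<lparr>carrier = hom A complex_units \<inter> extensional (carrier A),
      mult = (\<lambda>\<chi> \<xi>. \<lambda>a\<in>carrier A. \<chi> a * \<xi> a),
      one = (\<lambda>a\<in>carrier A. 1)\<rparr>"

definition cfuns :: "'a set \<Rightarrow> ('a \<Rightarrow> complex) set" where
  "cfuns S = S \<rightarrow>\<^sub>E UNIV"

definition fourier ::
    "('a, 'm) monoid_scheme \<Rightarrow> ('a \<Rightarrow> complex) \<Rightarrow> ('a \<Rightarrow> complex) \<Rightarrow> complex" where
  "fourier A =
     (\<lambda>\<phi>\<in>cfuns (carrier A). \<lambda>\<xi>\<in>carrier (character_group A). \<Sum>a\<in>carrier A. cnj (\<xi> a) * \<phi> a)"

definition twisted_pushforward ::
    "('a, 'm) monoid_scheme \<Rightarrow> ('b, 'n) monoid_scheme \<Rightarrow> ('a \<Rightarrow> 'b) \<Rightarrow> ('a \<Rightarrow> complex) \<Rightarrow>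
     ('a \<Rightarrow> complex) \<Rightarrow> 'b \<Rightarrow> complex" where
  "twisted_pushforward A B \<pi> \<zeta> =
     (\<lambda>\<phi>\<in>cfuns (carrier A). \<lambda>b\<in>carrier B. \<Sum>a\<in>{a \<in> carrier A. \<pi> a = b}. cnj (\<zeta> a) * \<phi> a)"

definition twisted_dual_map ::
    "('a, 'm) monoid_scheme \<Rightarrow> ('b, 'n) monoid_scheme \<Rightarrow> ('a \<Rightarrow> 'b) \<Rightarrow> ('a \<Rightarrow> complex) \<Rightarrow>
     ('b \<Rightarrow> complex) \<Rightarrow> 'a \<Rightarrow> complex" where
  "twisted_dual_map A B \<pi> \<zeta> =
     (\<lambda>\<xi>\<in>carrier (character_group B). compose (carrier A) \<xi> \<pi> \<otimes>\<^bsub>character_group A\<^esub> \<zeta>)"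

definition pullback ::
    "'x set \<Rightarrow> 'y set \<Rightarrow> ('x \<Rightarrow> 'y) \<Rightarrow> ('y \<Rightarrow> complex) \<Rightarrow> 'x \<Rightarrow> complex" where
  "pullback S T f = (\<lambda>\<psi>\<in>cfuns T. compose S \<psi> f)"

lemma comm_group_complex_units: "comm_group complex_units"
proof (rule comm_groupI)
  show "\<exists>y\<in>carrier complex_units. y \<otimes>\<^bsub>complex_units\<^esub> x = \<one>\<^bsub>complex_units\<^esub>"
    if "x \<in> carrier complex_units" for x
    using that by (intro bexI [of _ "inverse x"]) (auto simp: complex_units_def)
qed (auto simp: complex_units_def)

lemma comm_group_character_group:
  assumes "group A"
  shows "comm_group (character_group A)"
proof -
  interpret group A by fact
  show ?thesis
  proof (rule comm_groupI)
    fix \<chi> assume \<chi>: "\<chi> \<in> carrier (character_group A)"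
    define \<xi> where "\<xi> = (\<lambda>a\<in>carrier A. inverse (\<chi> a))"
    have "\<xi> \<in> carrier (character_group A)"
      using \<chi> by (auto simp: character_group_def complex_units_def hom_def Pi_iff \<xi>_def)
    moreover have "\<xi> \<otimes>\<^bsub>character_group A\<^esub> \<chi> = \<one>\<^bsub>character_group A\<^esub>"
      using \<chi> by (auto simp: character_group_def complex_units_def hom_def Pi_iff \<xi>_def
          intro!: restrict_ext)
    ultimately show "\<exists>\<xi>\<in>carrier (character_group A).
        \<xi> \<otimes>\<^bsub>character_group A\<^esub> \<chi> = \<one>\<^bsub>character_group A\<^esub>" by blast
  qed (auto simp: character_group_def complex_units_def hom_def Pi_iff mult_ac extensional_def
         fun_eq_iff restrict_def)
qed

lemma fourier_funcset:
  "fourier A \<in> cfuns (carrier A) \<rightarrow> cfuns (carrier (character_group A))"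
  by (auto simp: fourier_def cfuns_def)

lemma twisted_pushforward_funcset:
  "twisted_pushforward A B \<pi> \<zeta> \<in> cfuns (carrier A) \<rightarrow> cfuns (carrier B)"
  by (auto simp: twisted_pushforward_def cfuns_def)

lemma twisted_dual_map_funcset:
  assumes "group A" "\<pi> \<in> hom A B" "\<zeta> \<in> carrier (character_group A)"
  shows "twisted_dual_map A B \<pi> \<zeta> \<in> carrier (character_group B) \<rightarrow> carrier (character_group A)"
proof
  interpret group A by fact
  fix \<xi> assume "\<xi> \<in> carrier (character_group B)"
  then show "twisted_dual_map A B \<pi> \<zeta> \<xi> \<in> carrier (character_group A)"
    using assms(2,3)
    by (auto simp: twisted_dual_map_def character_group_def complex_units_def hom_def Pi_iff
        compose_def)
qed

lemma pullback_funcset: "pullback S T f \<in> cfuns T \<rightarrow> cfuns S"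
  by (auto simp: pullback_def cfuns_def compose_def)

end

theory Submission
  imports Defs
begin

text \<open>Evaluate both sides at \<phi> and a character \<xi> of \<open>B\<close>. Conjugation is
  multiplicative, so the left side is the sum over a in \<open>A\<close> of cnj(\<xi>(\<pi> a))
  cnj(\<zeta> a) \<phi>(a). Sorting the terms by b = \<pi> a makes the first factor constant on each
  fibre; what remains there is the twisted pushforward at b. \<open>fourier_twisted_dual_map\<close>
  is this computation; the theorem adds only bookkeeping about domains.\<close>

lemma fourier_twisted_dual_map:
  assumes A: "group A" and fin: "finite (carrier A)" "finite (carrier B)"
    and \<pi>: "\<pi> \<in> hom A B" and \<zeta>: "\<zeta> \<in> carrier (character_group A)"
    and \<phi>: "\<phi> \<in> cfuns (carrier A)" and \<xi>: "\<xi> \<in> carrier (character_group B)"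
  shows "fourier A \<phi> (twisted_dual_map A B \<pi> \<zeta> \<xi>) = fourier B (twisted_pushforward A B \<pi> \<zeta> \<phi>) \<xi>"
proof -
  \<comment> \<open>The bracketing keeps together the factors that form the pushforward once the
    first is pulled out.\<close>
  let ?h = "\<lambda>a. cnj (\<xi> (\<pi> a)) * (cnj (\<zeta> a) * \<phi> a)"
  have "fourier A \<phi> (twisted_dual_map A B \<pi> \<zeta> \<xi>)
      = (\<Sum>a\<in>carrier A. cnj (twisted_dual_map A B \<pi> \<zeta> \<xi> a) * \<phi> a)"
    using funcset_mem[OF twisted_dual_map_funcset[OF A \<pi> \<zeta>] \<xi>] \<phi> by (simp add: fourier_def)
  also have "\<dots> = (\<Sum>a\<in>carrier A. ?h a)"
    using \<xi> by (intro sum.cong)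
      (simp_all add: twisted_dual_map_def character_group_def compose_def mult_ac)
  \<comment> \<open>As \<pi> maps into \<open>carrier B\<close>, its fibres partition
    \<open>carrier A\<close>; points outside the image contribute empty sums.\<close>
  also have "\<dots> = (\<Sum>b\<in>carrier B. \<Sum>a\<in>{a \<in> carrier A. \<pi> a = b}. ?h a)"
    using hom_carrier[OF \<pi>] by (rule sum.group[OF fin, symmetric])
  also have "\<dots> = (\<Sum>b\<in>carrier B. cnj (\<xi> b) * twisted_pushforward A B \<pi> \<zeta> \<phi> b)"
    using \<phi> by (intro sum.cong) (simp_all add: twisted_pushforward_def sum_distrib_left)
  also have "\<dots> = fourier B (twisted_pushforward A B \<pi> \<zeta> \<phi>) \<xi>"
    using funcset_mem[OF twisted_pushforward_funcset[of A B \<pi> \<zeta>] \<phi>] \<xi> by (simp add: fourier_def)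
  finally show ?thesis .
qed

theorem proposition3p1p1:
  fixes A :: "('a, 'm) monoid_scheme" and B :: "('b, 'n) monoid_scheme"
    and \<pi> :: "'a \<Rightarrow> 'b" and \<zeta> :: "'a \<Rightarrow> complex"
  assumes "comm_group A" and "finite (carrier A)"
    and "comm_group B" and "finite (carrier B)"
    and "\<pi> \<in> hom A B"
    and "\<zeta> \<in> carrier (character_group A)"
  shows
    "compose (cfuns (carrier A))
       (pullback (carrier (character_group B)) (carrier (character_group A))
          (twisted_dual_map A B \<pi> \<zeta>))
       (fourier A)
     = compose (cfuns (carrier A)) (fourier B) (twisted_pushforward A B \<pi> \<zeta>)"
proof -
  have "pullback (carrier (character_group B)) (carrier (character_group A))
      (twisted_dual_map A B \<pi> \<zeta>) (fourier A \<phi>) = fourier B (twisted_pushforward A B \<pi> \<zeta> \<phi>)"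
    if \<phi>: "\<phi> \<in> cfuns (carrier A)" for \<phi>
  proof -
    have "fourier A \<phi> \<in> cfuns (carrier (character_group A))"
      using fourier_funcset \<phi> by (rule funcset_mem)
    \<comment> \<open>\<open>fourier B\<close> is unspecified off \<open>cfuns (carrier B)\<close>,
      so this membership is needed to see that its value is extensional.\<close>
    moreover have "twisted_pushforward A B \<pi> \<zeta> \<phi> \<in> cfuns (carrier B)"
      using twisted_pushforward_funcset \<phi> by (rule funcset_mem)
    then have "fourier B (twisted_pushforward A B \<pi> \<zeta> \<phi>) \<in> extensional (carrier (character_group B))"
      by (simp add: fourier_def)
    ultimately show ?thesis
      \<comment> \<open>Both sides are extensional on the characters of \<open>B\<close>, so
        agreement at each such character gives equality.\<close>
      using fourier_twisted_dual_map[OF comm_group.axioms(2)[OF assms(1)] assms(2,4-6) \<phi>]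
      by (intro extensionalityI[where A = "carrier (character_group B)"])
        (simp_all add: pullback_def compose_def)
  qed
  then show ?thesis
    unfolding compose_def by (rule restrict_ext)
qed

end
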